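(* Let $\lambda_1,\lambda_2\in\mathbb{R}$, let $A=\begin{pmatrix}\lambda_1&0\\0&\lambda_2\end{pmatrix}$, and let $T:\mathbb{R}^2\to\mathbb{R}^2$, $Tx=Ax$. (i) If $|\lambda_1|>1$ and $|\lambda_2|>1$, then $T$ is strongly sensitive in weak topology. (ii) Otherwise, $T$ is not strongly sensitive in weak topology.
   Context: Let $\mathbb{N}=\{1,2,3,\dots\}$. Continuous linear functionals on $\mathbb{R}^2$ are identified with vectors $x^*\in\mathbb{R}^2$ via $\langle x,x^*\rangle=x_1x_1^*+x_2x_2^*$, and $p_{x^*}(x)=|\langle x,x^*\rangle|$. $T$ is strongly sensitive in weak topology if there is $\delta>0$ such that for every nonzero $x^*$, every $x_0\in\mathbb{R}^2$ and every $\varepsilon>0$ there exist $x,y\in\mathbb{R}^2$ and $n\in\mathbb{N}$ with $p_{x^*}(x-x_0)<\varepsilon$, $p_{x^*}(y-x_0)<\varepsilon$ and $p_{x^*}(T^nx-T^ny)>\delta$. *)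

theory Defs
  imports "HOL-Analysis.Analysis"
begin

(* Functionals on R^2 are identified with vectors: the functional given by x' is x |-> inner x x'. *)
definition functional_seminorm :: "real ^ 2 \<Rightarrow> real ^ 2 \<Rightarrow> real" where
  "functional_seminorm x' x = \<bar>x \<bullet> x'\<bar>"

(* The number of iterations n is at least 1. The constant d is uniform in x', x0 and e. *)
definition strongly_sensitive_weak :: "(real ^ 2 \<Rightarrow> real ^ 2) \<Rightarrow> bool" where
  "strongly_sensitive_weak T \<longleftrightarrow>
    (\<exists>d>0. \<forall>x'. x' \<noteq> 0 \<longrightarrow> (\<forall>x0. \<forall>e>0. \<exists>x y. \<exists>n\<ge>1.
       functional_seminorm x' (x - x0) < e \<and>
       functional_seminorm x' (y - x0) < e \<and>
       functional_seminorm x' ((T ^^ n) x - (T ^^ n) y) > d))"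

end

theory Submission
  imports Defs
begin

text \<open>
  A diagonal map acts on each coordinate by a scalar, and so do its iterates.
  If both scalars exceed one in modulus, a nonzero functional has some nonzero coordinate \<open>i\<close>;
  a perturbation along the axis \<open>i\<close> can be made small for the functional, yet it stays on that axis
  and its size grows geometrically, so it passes any prescribed bound;
  in particular the constant \<open>1\<close> serves for all functionals and points at once.
  If one scalar has modulus at most one, the functional reading off that coordinate never sees
  two points move apart, so two points that it initially cannot separate by more than the given
  constant are never separated.
\<close>

lemma diagonal_iterate_nth:
  fixes T :: "real ^ 'n \<Rightarrow> real ^ 'n"
  assumes "\<And>x i. T x $ i = l i * x $ i"
  shows "(T ^^ n) x $ i = l i ^ n * x $ i"
  by (induction n) (simp_all add: assms)

lemma strongly_sensitive_weak_diagonal: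
  fixes T :: "real ^ 2 \<Rightarrow> real ^ 2"
  assumes T: "\<And>x i. T x $ i = l i * x $ i"
    and expanding: "\<And>i. \<bar>l i\<bar> > 1"
  shows "strongly_sensitive_weak T"
proof -
  have "\<exists>x y. \<exists>n\<ge>1. functional_seminorm x' (x - x0) < e \<and> functional_seminorm x' (y - x0) < e \<and>
          functional_seminorm x' ((T ^^ n) x - (T ^^ n) y) > 1"
    if "x' \<noteq> 0" "e > 0" for x' x0 :: "real ^ 2" and e :: real
  proof -
    obtain i where i: "x' $ i \<noteq> 0"
      using \<open>x' \<noteq> 0\<close> by (auto simp: vec_eq_iff)
    \<comment> \<open>The step along axis \<open>i\<close> is chosen so that the functional takes the value \<open>e / 2\<close> on it.\<close>
    define x where "x = x0 + axis i (e / (2 * x' $ i))"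
    obtain m where m: "\<bar>l i\<bar> ^ m > 2 / e"
      using real_arch_pow expanding by blast
    \<comment> \<open>Passing to \<open>Suc m\<close> ensures that at least one iteration is made.\<close>
    have "\<bar>l i\<bar> ^ Suc m > 2 / e"
      using m power_increasing[of m "Suc m" "\<bar>l i\<bar>"] expanding[of i] by linarith
    then have large: "\<bar>l i\<bar> ^ Suc m * (e / 2) > 1"
      using \<open>e > 0\<close> by (simp add: field_simps)
    have "(T ^^ Suc m) x - (T ^^ Suc m) x0 = axis i (l i ^ Suc m * (e / (2 * x' $ i)))"
      by (simp add: vec_eq_iff diagonal_iterate_nth[OF T] x_def axis_def algebra_simps
          del: funpow.simps power_Suc)
    then have "((T ^^ Suc m) x - (T ^^ Suc m) x0) \<bullet> x' = l i ^ Suc m * (e / 2)"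
      using i by (simp add: inner_axis' del: funpow.simps power_Suc)
    then have "functional_seminorm x' ((T ^^ Suc m) x - (T ^^ Suc m) x0) = \<bar>l i\<bar> ^ Suc m * (e / 2)"
      unfolding functional_seminorm_def using \<open>e > 0\<close> by (simp only: abs_mult power_abs)
    then have "functional_seminorm x' ((T ^^ Suc m) x - (T ^^ Suc m) x0) > 1"
      using large by simp
    moreover have "functional_seminorm x' (x - x0) < e"
      using i \<open>e > 0\<close> by (simp add: functional_seminorm_def x_def inner_axis')
    moreover have "functional_seminorm x' (x0 - x0) < e"
      using \<open>e > 0\<close> by (simp add: functional_seminorm_def)
    ultimately show ?thesis
      by (intro exI[of _ x] exI[of _ x0] exI[of _ "Suc m"]) simp
  qed
  then show ?thesis
    unfolding strongly_sensitive_weak_def by (intro exI[of _ 1]) simp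
qed

lemma not_strongly_sensitive_weak_diagonal:
  fixes T :: "real ^ 2 \<Rightarrow> real ^ 2"
  assumes T: "\<And>x i. T x $ i = l i * x $ i"
    and nonexpanding: "\<bar>l j\<bar> \<le> 1"
  shows "\<not> strongly_sensitive_weak T"
proof
  assume "strongly_sensitive_weak T"
  then obtain d where "d > 0" and d: "\<And>x' x0 e. x' \<noteq> 0 \<Longrightarrow> e > 0 \<Longrightarrow> \<exists>x y. \<exists>n\<ge>1.
       functional_seminorm x' (x - x0) < e \<and> functional_seminorm x' (y - x0) < e \<and>
       functional_seminorm x' ((T ^^ n) x - (T ^^ n) y) > d"
    unfolding strongly_sensitive_weak_def by blast
  have coordinate: "functional_seminorm (axis j 1) z = \<bar>z $ j\<bar>" for z
    by (simp add: functional_seminorm_def inner_axis)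
  \<comment> \<open>Two points within \<open>d / 2\<close> of the origin are less than \<open>d\<close> apart.\<close>
  obtain x y n where "\<bar>x $ j\<bar> < d / 2" "\<bar>y $ j\<bar> < d / 2"
    and separated: "\<bar>(T ^^ n) x $ j - (T ^^ n) y $ j\<bar> > d"
    using d[of "axis j 1" "d / 2" 0] \<open>d > 0\<close> by (auto simp: coordinate axis_eq_0_iff)
  then have close: "\<bar>x $ j - y $ j\<bar> < d"
    by linarith
  have "\<bar>(T ^^ n) x $ j - (T ^^ n) y $ j\<bar> = \<bar>l j\<bar> ^ n * \<bar>x $ j - y $ j\<bar>"
    by (simp add: diagonal_iterate_nth[OF T] abs_mult power_abs flip: right_diff_distrib)
  also have "\<dots> \<le> 1 * \<bar>x $ j - y $ j\<bar>"
    using nonexpanding by (intro mult_right_mono power_le_one) auto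
  also have "\<dots> < d"
    using close by simp
  finally show False
    using separated by simp
qed

theorem theorem5p1:
  fixes l1 l2 :: real and A :: "real ^ 2 ^ 2" and T :: "real ^ 2 \<Rightarrow> real ^ 2"
  assumes A: "A = vector [vector [l1, 0], vector [0, l2]]"
    and T: "T = (\<lambda>x. A *v x)"
  shows "(\<bar>l1\<bar> > 1 \<and> \<bar>l2\<bar> > 1 \<longrightarrow> strongly_sensitive_weak T) \<and>
         (\<not> (\<bar>l1\<bar> > 1 \<and> \<bar>l2\<bar> > 1) \<longrightarrow> \<not> strongly_sensitive_weak T)"
proof -
  define l :: "2 \<Rightarrow> real" where "l i = (if i = 1 then l1 else l2)" for i
  have l: "l 1 = l1" "l 2 = l2"
    by (simp_all add: l_def)
  have diagonal: "T x $ i = l i * x $ i" for x i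
    using exhaust_2[of i] by (auto simp: T A l matrix_vector_mult_def sum_2)
  have "strongly_sensitive_weak T" if "\<bar>l1\<bar> > 1 \<and> \<bar>l2\<bar> > 1"
    using that by (intro strongly_sensitive_weak_diagonal[OF diagonal]) (simp add: l_def)
  moreover have "\<not> strongly_sensitive_weak T" if "\<not> (\<bar>l1\<bar> > 1 \<and> \<bar>l2\<bar> > 1)"
    using that not_strongly_sensitive_weak_diagonal[OF diagonal, of 1]
      not_strongly_sensitive_weak_diagonal[OF diagonal, of 2] by (auto simp: l not_less)
  ultimately show ?thesis
    by blast
qed

end
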